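(* For every $b\in\overline B$, $$P_{\mathrm{SCF}}(b)=\Big\{x\in P_{\mathrm{AP}} : \sum_{ij\in\delta^+(S)}x_{ij}\geq \sum_{i\in S}b_i\ \text{ for all } S\in\mathcal S_1\Big\}.$$
   Context: Let $n\ge 4$, $N=\{1,\dots,n\}$, $A=\{ij : i,j\in N,\ i\ne j\}$, $N_1=N\setminus\{1\}$. $\mathcal S_1$ is the set of subsets of $N_1$ of size at least 2. For $S\subseteq N$, $\delta^+(S)=\{ij\in A : i\in S,\ j\notin S\}$ and $\delta^-(S)=\{ij\in A : i\notin S,\ j\in S\}$, with $\delta^\pm(i)=\delta^\pm(\{i\})$. $P_{\mathrm{AP}}$ is the set of $x\in[0,1]^A$ with $\sum_{j\neq i}x_{ij}=1$ and $\sum_{j\ne i}x_{ji}=1$ for all $i\in N$. $\overline B=\{b\in\mathbb R_+^{N_1} : \sum_{i\in N_1}b_i=1\}$, where $\mathbb R_+$ denotes the nonnegative reals. For $b\in\overline B$, $Q_{\mathrm{SCF}}(b)$ is the set of $(x,f)\in P_{\mathrm{AP}}\times\mathbb R^A_+$ with $$\sum_{ij\in\delta^+(i)}f_{ij}-\sum_{ji\in\delta^-(i)}f_{ji}=-b_i\ \text{ for all } i\in N_1,\qquad f_{ij}\le x_{ij}\ \text{ for all } ij\in A,$$ and $P_{\mathrm{SCF}}(b)=\{x : \exists f,\ (x,f)\in Q_{\mathrm{SCF}}(b)\}$ is its projection onto the $x$ variables. *)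

theory Defs
  imports Complex_Main "HOL-Library.FuncSet"
begin

text \<open>
  A vector indexed by a finite set \<open>I\<close>, i.e. an element of \<open>\<real>\<^sup>I\<close>, is an extensional function on \<open>I\<close>
  (\<open>I \<rightarrow>\<^sub>E _\<close>, value \<^const>\<open>undefined\<close> outside \<open>I\<close>), so that two vectors are equal iff they agree on
  \<open>I\<close>. The arc \<open>ij\<close> is the pair \<open>(i, j)\<close>.
\<close>

definition nodes :: "nat \<Rightarrow> nat set" where
  "nodes n = {1..n}"

definition nodes1 :: "nat \<Rightarrow> nat set" where
  "nodes1 n = nodes n - {1}"

definition arcs :: "nat \<Rightarrow> (nat \<times> nat) set" where
  "arcs n = {(i, j). i \<in> nodes n \<and> j \<in> nodes n \<and> i \<noteq> j}"

definition subsets1 :: "nat \<Rightarrow> nat set set" where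
  "subsets1 n = {S. S \<subseteq> nodes1 n \<and> card S \<ge> 2}"

definition delta_out :: "nat \<Rightarrow> nat set \<Rightarrow> (nat \<times> nat) set" where
  "delta_out n S = {(i, j). (i, j) \<in> arcs n \<and> i \<in> S \<and> j \<notin> S}"

definition delta_in :: "nat \<Rightarrow> nat set \<Rightarrow> (nat \<times> nat) set" where
  "delta_in n S = {(i, j). (i, j) \<in> arcs n \<and> i \<notin> S \<and> j \<in> S}"

definition P_AP :: "nat \<Rightarrow> (nat \<times> nat \<Rightarrow> real) set" where
  "P_AP n = {x \<in> arcs n \<rightarrow>\<^sub>E {0..1}.
     \<forall>i\<in>nodes n. (\<Sum>j\<in>nodes n - {i}. x (i, j)) = 1 \<and> (\<Sum>j\<in>nodes n - {i}. x (j, i)) = 1}"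

definition B_bar :: "nat \<Rightarrow> (nat \<Rightarrow> real) set" where
  "B_bar n = {b \<in> nodes1 n \<rightarrow>\<^sub>E {0..}. (\<Sum>i\<in>nodes1 n. b i) = 1}"

definition Q_SCF :: "nat \<Rightarrow> (nat \<Rightarrow> real) \<Rightarrow> ((nat \<times> nat \<Rightarrow> real) \<times> (nat \<times> nat \<Rightarrow> real)) set" where
  "Q_SCF n b = {(x, f). x \<in> P_AP n \<and> f \<in> arcs n \<rightarrow>\<^sub>E {0..} \<and>
     (\<forall>i\<in>nodes1 n. (\<Sum>a\<in>delta_out n {i}. f a) - (\<Sum>a\<in>delta_in n {i}. f a) = - b i) \<and>
     (\<forall>a\<in>arcs n. f a \<le> x a)}"

definition P_SCF :: "nat \<Rightarrow> (nat \<Rightarrow> real) \<Rightarrow> (nat \<times> nat \<Rightarrow> real) set" where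
  "P_SCF n b = {x. \<exists>f. (x, f) \<in> Q_SCF n b}"

end

theory Submission
  imports Defs "HOL-Analysis.Function_Topology"
begin

text \<open>
  The theorem is the feasibility criterion for single-source flows (Gale's form of max-flow
  min-cut) on the complete digraph with capacities \<open>x\<close>, where node \<open>1\<close> is the source and node
  \<open>i \<noteq> 1\<close> demands \<open>b i\<close>: a flow exists iff every \<open>S \<subseteq> N\<^sub>1\<close> has entering capacity at least its
  total demand. Since \<open>x\<close> is an assignment, the capacity entering \<open>S\<close> equals the capacity
  leaving \<open>S\<close>, which turns this into the displayed inequalities; the cut conditions of sets with
  at most one element are automatic, because one unit enters each node and \<open>b i \<le> 1\<close>.

  Necessity of the cut condition is conservation of flow summed over \<open>S\<close>
  (\<open>sum_net_inflow_singleton\<close>). Sufficiency (\<open>feasible_flow_exists\<close>) is obtained without augmenting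
  paths: by compactness some \<open>f\<close> with \<open>0 \<le> f \<le> x\<close> minimises the sum of the squared deficits, the
  deficit of \<open>i\<close> being \<open>b i\<close> minus the net inflow at \<open>i\<close>, and that of the source being \<open>0\<close>.
  Shifting flow on a single arc towards the end with the larger deficit would lower this sum, so an
  arc from a smaller to a larger deficit is saturated and an arc from a larger to a smaller one is
  empty (\<open>saturated_or_empty_at_minimum\<close>). Hence the set of nodes with positive deficit
  receives its whole entering capacity and emits nothing, so by the cut condition its total deficit
  is at most \<open>0\<close> and the set is empty; dually, nothing enters the set of nodes with
  negative deficit, so its total deficit is at least \<open>0\<close> and it is empty too. All demands are met.
\<close>

section \<open>Net inflow into a set of nodes\<close>

text \<open>
  Weighting each arc by a difference of indicators makes the quantity additive in \<open>S\<close>: arcs inside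
  \<open>S\<close> and loops cancel on their own.
\<close>
definition net_inflow :: "('v \<times> 'v) set \<Rightarrow> ('v \<times> 'v \<Rightarrow> real) \<Rightarrow> 'v set \<Rightarrow> real" where
  "net_inflow E f S = (\<Sum>a\<in>E. f a * (of_bool (snd a \<in> S) - of_bool (fst a \<in> S)))"

lemma sum_net_inflow_singleton:
  assumes "finite S"
  shows "(\<Sum>i\<in>S. net_inflow E f {i}) = net_inflow E f S"
proof -
  have ind: "(\<Sum>i\<in>S. of_bool (v \<in> {i})) = (of_bool (v \<in> S) :: real)" for v
    using assms by (simp add: of_bool_def sum.delta')
  have "(\<Sum>i\<in>S. net_inflow E f {i})
      = (\<Sum>a\<in>E. \<Sum>i\<in>S. f a * (of_bool (snd a \<in> {i}) - of_bool (fst a \<in> {i})))"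
    unfolding net_inflow_def by (rule sum.swap)
  also have "\<dots> = net_inflow E f S"
    unfolding net_inflow_def sum_distrib_left[symmetric] sum_subtractf ind ..
  finally show ?thesis .
qed

lemma net_inflow_entering_minus_leaving:
  assumes "finite E"
  shows "net_inflow E f S =
    (\<Sum>a | a \<in> E \<and> fst a \<notin> S \<and> snd a \<in> S. f a) - (\<Sum>a | a \<in> E \<and> fst a \<in> S \<and> snd a \<notin> S. f a)"
proof -
  have "(\<Sum>a | a \<in> E \<and> P a. f a) = (\<Sum>a\<in>E. f a * of_bool (P a))" for P
    using assms by (simp add: sum.inter_filter[symmetric] of_bool_def if_distrib cong: if_cong)
  then show ?thesis
    unfolding net_inflow_def
    by (auto simp: sum_subtractf[symmetric] intro!: sum.cong)
qed

lemma net_inflow_fun_upd: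
  assumes "finite E" "a \<in> E"
  shows "net_inflow E (f(a := f a + t)) S =
    net_inflow E f S + t * (of_bool (snd a \<in> S) - of_bool (fst a \<in> S))"
proof -
  define w where "w = (\<lambda>a. of_bool (snd a \<in> S) - of_bool (fst a \<in> S) :: real)"
  have "(\<Sum>x\<in>E. (f(a := f a + t)) x * w x) = (\<Sum>x\<in>E. f x * w x + (if x = a then t * w a else 0))"
    by (intro sum.cong) (auto simp: distrib_right)
  then show ?thesis
    using assms unfolding net_inflow_def w_def by (simp add: sum.distrib)
qed

section \<open>Flows meeting prescribed demands\<close>

lemma linear_coeff_nonneg_if_quadratic_nonneg:
  fixes c k m :: real
  assumes nonneg: "\<And>t. 0 \<le> t \<Longrightarrow> t \<le> m \<Longrightarrow> 0 \<le> c * t + k * t\<^sup>2"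
    and "0 < m" "0 \<le> k"
  shows "0 \<le> c"
proof (rule ccontr)
  assume "\<not> 0 \<le> c"
  then have c: "c < 0" by simp
  \<comment> \<open>At this step length the linear term still dominates: \<open>k * t < - c\<close>.\<close>
  define t where "t = min m (- c / (k + 1))"
  have t: "0 < t" "t \<le> m" and "t \<le> - c / (k + 1)"
    using c assms(2,3) by (auto simp: t_def divide_neg_pos)
  then have "t * (k + 1) \<le> - c"
    using assms(3) by (simp add: field_simps)
  then have "c + k * t < 0"
    using t by (simp add: algebra_simps)
  then have "t * (c + k * t) < 0"
    using t by (simp add: mult_pos_neg)
  then show False
    using nonneg[of t] t by (simp add: power2_eq_square algebra_simps)
qed

text \<open>
  The first-order optimality conditions: changing \<open>f\<close> on the arc \<open>a\<close> alone by \<open>t\<close> changes the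
  sum of squares by \<open>2 * t * (e (fst a) - e (snd a))\<close> up to order \<open>t\<^sup>2\<close>. The root nodes, those
  outside \<open>W\<close>, do not contribute to the sum, which is why they get deficit \<open>0\<close>.
\<close>
lemma saturated_or_empty_at_minimum:
  fixes E :: "('v \<times> 'v) set" and W :: "'v set" and u f :: "'v \<times> 'v \<Rightarrow> real" and b :: "'v \<Rightarrow> real"
  defines "e \<equiv> \<lambda>g i. if i \<in> W then b i - net_inflow E g {i} else 0"
  assumes fin: "finite E" "finite W" and a: "a \<in> E"
    and f: "\<forall>a\<in>E. 0 \<le> f a \<and> f a \<le> u a"
    and min: "\<forall>g. (\<forall>a\<in>E. 0 \<le> g a \<and> g a \<le> u a) \<longrightarrow>
      (\<Sum>i\<in>W. (b i - net_inflow E f {i})\<^sup>2) \<le> (\<Sum>i\<in>W. (b i - net_inflow E g {i})\<^sup>2)"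
  shows "e f (fst a) < e f (snd a) \<Longrightarrow> f a = u a"
    and "e f (snd a) < e f (fst a) \<Longrightarrow> f a = 0"
proof -
  define c :: "'v \<Rightarrow> real" where "c = (\<lambda>i. of_bool (fst a = i) - of_bool (snd a = i))"
  define d where "d = e f (fst a) - e f (snd a)"
  define k where "k = (\<Sum>i\<in>W. (c i)\<^sup>2)"
  have k: "0 \<le> k"
    unfolding k_def by (simp add: sum_nonneg)
  have "(\<Sum>i\<in>W. e f i * of_bool (v = i)) = e f v" for v
    using fin by (simp add: of_bool_def if_distrib e_def cong: if_cong)
  then have d_sum: "(\<Sum>i\<in>W. e f i * c i) = d"
    unfolding c_def d_def by (simp add: right_diff_distrib sum_subtractf)
  have step: "0 \<le> 2 * t * d + k * t\<^sup>2" if t: "0 \<le> f a + t" "f a + t \<le> u a" for t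
  proof -
    define g where "g = f(a := f a + t)"
    have eg: "e g i = e f i + t * c i" if "i \<in> W" for i
      using that unfolding e_def g_def c_def net_inflow_fun_upd[OF fin(1) a]
      by (simp add: algebra_simps)
    have "(\<Sum>i\<in>W. (b i - net_inflow E f {i})\<^sup>2) \<le> (\<Sum>i\<in>W. (b i - net_inflow E g {i})\<^sup>2)"
      using f t by (intro min[rule_format]) (auto simp: g_def)
    then have "(\<Sum>i\<in>W. (e f i)\<^sup>2) \<le> (\<Sum>i\<in>W. (e g i)\<^sup>2)"
      by (simp add: e_def)
    also have "\<dots> = (\<Sum>i\<in>W. (e f i)\<^sup>2 + 2 * t * (e f i * c i) + (c i)\<^sup>2 * t\<^sup>2)"
      by (intro sum.cong) (auto simp: eg power2_eq_square algebra_simps)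
    also have "\<dots> = (\<Sum>i\<in>W. (e f i)\<^sup>2) + 2 * t * d + k * t\<^sup>2"
      unfolding k_def d_sum[symmetric] by (simp add: sum.distrib sum_distrib_left sum_distrib_right)
    finally show ?thesis by simp
  qed
  show "f a = u a" if "e f (fst a) < e f (snd a)"
  proof (rule ccontr)
    assume "f a \<noteq> u a"
    then have m: "0 < u a - f a" using bspec[OF f a] by simp
    have "0 \<le> 2 * d"
    proof (rule linear_coeff_nonneg_if_quadratic_nonneg[OF _ m k])
      fix t assume "0 \<le> t" "t \<le> u a - f a"
      then show "0 \<le> 2 * d * t + k * t\<^sup>2"
        using step[of t] bspec[OF f a] by (simp add: mult_ac)
    qed
    then show False using that by (simp add: d_def)
  qed
  show "f a = 0" if "e f (snd a) < e f (fst a)"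
  proof (rule ccontr)
    assume "f a \<noteq> 0"
    then have m: "0 < f a" using bspec[OF f a] by simp
    have "0 \<le> - 2 * d"
    proof (rule linear_coeff_nonneg_if_quadratic_nonneg[OF _ m k])
      fix t assume "0 \<le> t" "t \<le> f a"
      then show "0 \<le> - 2 * d * t + k * t\<^sup>2"
        using step[of "- t"] bspec[OF f a] by (simp add: mult_ac)
    qed
    then show False using that by (simp add: d_def)
  qed
qed

text \<open>
  The box of admissible \<open>f\<close> is a product of compact intervals; off \<open>E\<close> the interval is
  \<open>{0..0}\<close>, so that the whole box lies in the product topology of \<open>'v \<times> 'v \<Rightarrow> real\<close>.
\<close>
lemma squared_deficit_minimum_exists:
  fixes E :: "('v \<times> 'v) set" and u :: "'v \<times> 'v \<Rightarrow> real" and b :: "'v \<Rightarrow> real"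
  assumes u: "\<forall>a\<in>E. 0 \<le> u a"
  shows "\<exists>f. (\<forall>a\<in>E. 0 \<le> f a \<and> f a \<le> u a) \<and>
    (\<forall>g. (\<forall>a\<in>E. 0 \<le> g a \<and> g a \<le> u a) \<longrightarrow>
      (\<Sum>i\<in>W. (b i - net_inflow E f {i})\<^sup>2) \<le> (\<Sum>i\<in>W. (b i - net_inflow E g {i})\<^sup>2))"
proof -
  define box where "box = PiE UNIV (\<lambda>a. {0..if a \<in> E then u a else 0})"
  define \<Phi> where "\<Phi> = (\<lambda>f. \<Sum>i\<in>W. (b i - net_inflow E f {i})\<^sup>2)"
  have box_iff: "f \<in> box \<longleftrightarrow> (\<forall>a\<in>E. 0 \<le> f a \<and> f a \<le> u a) \<and> (\<forall>a. a \<notin> E \<longrightarrow> f a = 0)" for f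
    unfolding box_def by (auto simp: PiE_iff split: if_splits) (metis order_antisym order_refl)+
  have "compactin (product_topology (\<lambda>_. euclidean) UNIV) box"
    unfolding box_def by (simp add: compactin_PiE)
  then have "compact box"
    by (simp add: euclidean_product_topology)
  have "(\<lambda>_. 0) \<in> box"
    using u by (simp add: box_iff)
  then have "box \<noteq> {}" by blast
  have "continuous_on UNIV \<Phi>"
    unfolding \<Phi>_def net_inflow_def by (intro continuous_intros) simp_all
  then have "continuous_on box \<Phi>"
    by (rule continuous_on_subset) simp
  from continuous_attains_inf[OF \<open>compact box\<close> \<open>box \<noteq> {}\<close> this]
  obtain f where f: "f \<in> box" and min: "\<forall>g\<in>box. \<Phi> f \<le> \<Phi> g" ..
  have "\<Phi> f \<le> \<Phi> g" if "\<forall>a\<in>E. 0 \<le> g a \<and> g a \<le> u a" for g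
  proof -
    define h where "h = (\<lambda>a. if a \<in> E then g a else 0)"
    have "h \<in> box" using that by (simp add: box_iff h_def)
    moreover have "net_inflow E h = net_inflow E g"
      unfolding net_inflow_def h_def by (intro ext sum.cong) auto
    then have "\<Phi> h = \<Phi> g" by (simp add: \<Phi>_def)
    ultimately show ?thesis using min by metis
  qed
  with f show ?thesis
    unfolding \<Phi>_def box_iff by blast
qed

text \<open>
  Nodes outside \<open>W\<close> act as sources without a prescribed supply, so only lower bounds on the
  capacity entering subsets of \<open>W\<close> are needed.
\<close>
theorem feasible_flow_exists:
  fixes E :: "('v \<times> 'v) set" and u :: "'v \<times> 'v \<Rightarrow> real" and b :: "'v \<Rightarrow> real"
  assumes fin: "finite E" "finite W"
    and u: "\<forall>a\<in>E. 0 \<le> u a"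
    and b: "\<And>i. i \<in> W \<Longrightarrow> 0 \<le> b i"
    and cut: "\<And>S. S \<subseteq> W \<Longrightarrow> (\<Sum>i\<in>S. b i) \<le> (\<Sum>a | a \<in> E \<and> fst a \<notin> S \<and> snd a \<in> S. u a)"
  shows "\<exists>f. (\<forall>a\<in>E. 0 \<le> f a \<and> f a \<le> u a) \<and> (\<forall>i\<in>W. net_inflow E f {i} = b i)"
proof -
  obtain f where f: "\<forall>a\<in>E. 0 \<le> f a \<and> f a \<le> u a"
    and min: "\<forall>g. (\<forall>a\<in>E. 0 \<le> g a \<and> g a \<le> u a) \<longrightarrow>
      (\<Sum>i\<in>W. (b i - net_inflow E f {i})\<^sup>2) \<le> (\<Sum>i\<in>W. (b i - net_inflow E g {i})\<^sup>2)"
    using squared_deficit_minimum_exists[OF u, of b W] by (elim exE conjE)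
  define e where "e = (\<lambda>i. if i \<in> W then b i - net_inflow E f {i} else 0)"
  have saturated: "f a = u a" if "a \<in> E" "e (fst a) < e (snd a)" for a
    using saturated_or_empty_at_minimum(1)[OF fin that(1) f min] that(2)
    unfolding e_def by simp
  have empty: "f a = 0" if "a \<in> E" "e (snd a) < e (fst a)" for a
    using saturated_or_empty_at_minimum(2)[OF fin that(1) f min] that(2)
    unfolding e_def by simp
  have deficit_sum: "(\<Sum>i\<in>S. e i) = (\<Sum>i\<in>S. b i) - net_inflow E f S" if "S \<subseteq> W" for S
  proof -
    have "(\<Sum>i\<in>S. e i) = (\<Sum>i\<in>S. b i - net_inflow E f {i})"
      using that by (intro sum.cong) (auto simp: e_def)
    then show ?thesis
      using sum_net_inflow_singleton[OF finite_subset[OF that fin(2)], of E f]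
      by (simp add: sum_subtractf)
  qed
  have nonpos: "e i \<le> 0" for i
  proof (rule ccontr)
    assume i: "\<not> e i \<le> 0"
    define S where "S = {i. 0 < e i}"
    have S: "S \<subseteq> W" "i \<in> S" using i by (auto simp: S_def e_def split: if_splits)
    have "(\<Sum>a | a \<in> E \<and> fst a \<notin> S \<and> snd a \<in> S. f a) = (\<Sum>a | a \<in> E \<and> fst a \<notin> S \<and> snd a \<in> S. u a)"
      by (intro sum.cong) (auto simp: S_def intro!: saturated)
    moreover have "(\<Sum>a | a \<in> E \<and> fst a \<in> S \<and> snd a \<notin> S. f a) = 0"
      by (intro sum.neutral) (auto simp: S_def intro!: empty)
    ultimately have "(\<Sum>i\<in>S. e i) \<le> 0"
      using cut[OF S(1)] by (simp add: deficit_sum[OF S(1)] net_inflow_entering_minus_leaving[OF fin(1)])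
    moreover have "0 < (\<Sum>i\<in>S. e i)"
      using S finite_subset[OF S(1) fin(2)] by (intro sum_pos) (auto simp: S_def)
    ultimately show False by simp
  qed
  have nonneg: "0 \<le> e i" for i
  proof (rule ccontr)
    assume i: "\<not> 0 \<le> e i"
    define S where "S = {i. e i < 0}"
    have S: "S \<subseteq> W" "i \<in> S" using i by (auto simp: S_def e_def split: if_splits)
    have "(\<Sum>a | a \<in> E \<and> fst a \<notin> S \<and> snd a \<in> S. f a) = 0"
      by (intro sum.neutral) (auto simp: S_def intro!: empty)
    moreover have "0 \<le> (\<Sum>a | a \<in> E \<and> fst a \<in> S \<and> snd a \<notin> S. f a)"
      using f by (intro sum_nonneg) auto
    moreover have "0 \<le> (\<Sum>i\<in>S. b i)"
      using b S(1) by (intro sum_nonneg) auto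
    ultimately have "0 \<le> (\<Sum>i\<in>S. e i)"
      by (simp add: deficit_sum[OF S(1)] net_inflow_entering_minus_leaving[OF fin(1)])
    moreover have "0 < (\<Sum>i\<in>S. - e i)"
      using S finite_subset[OF S(1) fin(2)] by (intro sum_pos) (auto simp: S_def)
    ultimately show False by (simp add: sum_negf)
  qed
  have "net_inflow E f {i} = b i" if "i \<in> W" for i
    using nonpos[of i] nonneg[of i] that by (simp add: e_def)
  with f show ?thesis by blast
qed

section \<open>Cuts of the complete digraph under an assignment\<close>

lemma finite_arcs: "finite (arcs n)"
  by (rule finite_subset[of _ "{1..n} \<times> {1..n}"]) (auto simp: arcs_def nodes_def)

lemma delta_in_eq: "delta_in n S = {a. a \<in> arcs n \<and> fst a \<notin> S \<and> snd a \<in> S}"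
  by (auto simp: delta_in_def)

lemma delta_out_eq: "delta_out n S = {a. a \<in> arcs n \<and> fst a \<in> S \<and> snd a \<notin> S}"
  by (auto simp: delta_out_def)

lemma net_inflow_arcs:
  "net_inflow (arcs n) f S = (\<Sum>a\<in>delta_in n S. f a) - (\<Sum>a\<in>delta_out n S. f a)"
  unfolding delta_in_eq delta_out_eq by (rule net_inflow_entering_minus_leaving[OF finite_arcs])

lemma sum_delta_in_singleton:
  assumes "x \<in> P_AP n" "i \<in> nodes n"
  shows "(\<Sum>a\<in>delta_in n {i}. x a) = 1"
proof -
  have "delta_in n {i} = (\<lambda>j. (j, i)) ` (nodes n - {i})"
    using assms(2) by (auto simp: delta_in_def arcs_def)
  then have "(\<Sum>a\<in>delta_in n {i}. x a) = (\<Sum>j\<in>nodes n - {i}. x (j, i))"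
    by (simp add: sum.reindex inj_on_def)
  then show ?thesis using assms by (simp add: P_AP_def)
qed

lemma sum_delta_out_singleton:
  assumes "x \<in> P_AP n" "i \<in> nodes n"
  shows "(\<Sum>a\<in>delta_out n {i}. x a) = 1"
proof -
  have "delta_out n {i} = (\<lambda>j. (i, j)) ` (nodes n - {i})"
    using assms(2) by (auto simp: delta_out_def arcs_def)
  then have "(\<Sum>a\<in>delta_out n {i}. x a) = (\<Sum>j\<in>nodes n - {i}. x (i, j))"
    by (simp add: sum.reindex inj_on_def)
  then show ?thesis using assms by (simp add: P_AP_def)
qed

text \<open>An assignment is a circulation: it conserves flow at every node, hence across every cut.\<close>
lemma assignment_cut_balanced:
  assumes "x \<in> P_AP n" "S \<subseteq> nodes n"
  shows "(\<Sum>a\<in>delta_in n S. x a) = (\<Sum>a\<in>delta_out n S. x a)"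
proof -
  have "finite S"
    using assms(2) by (rule finite_subset) (simp add: nodes_def)
  then have "net_inflow (arcs n) x S = (\<Sum>i\<in>S. net_inflow (arcs n) x {i})"
    by (rule sum_net_inflow_singleton[symmetric])
  also have "\<dots> = 0"
    using assms by (intro sum.neutral)
      (auto simp: net_inflow_arcs sum_delta_in_singleton sum_delta_out_singleton)
  finally show ?thesis by (simp add: net_inflow_arcs)
qed

theorem proposition27:
  fixes n :: nat and b :: "nat \<Rightarrow> real"
  assumes "n \<ge> 4" and "b \<in> B_bar n"
  shows "P_SCF n b =
    {x \<in> P_AP n. \<forall>S\<in>subsets1 n. (\<Sum>a\<in>delta_out n S. x a) \<ge> (\<Sum>i\<in>S. b i)}"
proof (intro set_eqI iffI)
  fix x assume "x \<in> P_SCF n b"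
  then obtain f where x: "x \<in> P_AP n" and f: "f \<in> arcs n \<rightarrow>\<^sub>E {0..}"
    and bal: "\<And>i. i \<in> nodes1 n \<Longrightarrow> (\<Sum>a\<in>delta_out n {i}. f a) - (\<Sum>a\<in>delta_in n {i}. f a) = - b i"
    and le: "\<And>a. a \<in> arcs n \<Longrightarrow> f a \<le> x a"
    unfolding P_SCF_def Q_SCF_def by auto
  have "(\<Sum>i\<in>S. b i) \<le> (\<Sum>a\<in>delta_out n S. x a)" if "S \<in> subsets1 n" for S
  proof -
    have S: "S \<subseteq> nodes1 n" "S \<subseteq> nodes n" "finite S"
      using that finite_subset[of S "{1..n}"] by (auto simp: subsets1_def nodes1_def nodes_def)
    have "(\<Sum>i\<in>S. b i) = (\<Sum>i\<in>S. net_inflow (arcs n) f {i})"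
      using S(1) bal by (intro sum.cong) (force simp: net_inflow_arcs)+
    also have "\<dots> = (\<Sum>a\<in>delta_in n S. f a) - (\<Sum>a\<in>delta_out n S. f a)"
      by (simp only: sum_net_inflow_singleton[OF S(3)]) (simp only: net_inflow_arcs)
    also have "\<dots> \<le> (\<Sum>a\<in>delta_in n S. f a)"
      using f by (auto simp: delta_out_eq PiE_iff intro!: sum_nonneg)
    also have "\<dots> \<le> (\<Sum>a\<in>delta_in n S. x a)"
      using le by (intro sum_mono) (simp add: delta_in_eq)
    also have "\<dots> = (\<Sum>a\<in>delta_out n S. x a)"
      by (rule assignment_cut_balanced[OF x S(2)])
    finally show ?thesis .
  qed
  with x show "x \<in> {x \<in> P_AP n. \<forall>S\<in>subsets1 n. (\<Sum>a\<in>delta_out n S. x a) \<ge> (\<Sum>i\<in>S. b i)}"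
    by blast
next
  fix x assume "x \<in> {x \<in> P_AP n. \<forall>S\<in>subsets1 n. (\<Sum>a\<in>delta_out n S. x a) \<ge> (\<Sum>i\<in>S. b i)}"
  then have x: "x \<in> P_AP n"
    and out: "\<And>S. S \<in> subsets1 n \<Longrightarrow> (\<Sum>i\<in>S. b i) \<le> (\<Sum>a\<in>delta_out n S. x a)"
    by auto
  have fin: "finite (nodes1 n)" by (simp add: nodes1_def nodes_def)
  have b0: "0 \<le> b i" if "i \<in> nodes1 n" for i
    using assms(2) that by (auto simp: B_bar_def PiE_iff)
  have cut: "(\<Sum>i\<in>S. b i) \<le> (\<Sum>a\<in>delta_in n S. x a)" if S: "S \<subseteq> nodes1 n" for S
  proof -
    consider "S \<in> subsets1 n" | "S = {}" | i where "S = {i}"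
    proof -
      have "card S \<ge> 2 \<or> card S = 0 \<or> card S = 1" by linarith
      then show thesis
        using S finite_subset[OF S fin] that by (auto simp: subsets1_def card_1_singleton_iff)
    qed
    then show ?thesis
    proof cases
      case 1
      have "S \<subseteq> nodes n" using S by (auto simp: nodes1_def)
      then show ?thesis using out[OF 1] assignment_cut_balanced[OF x] by simp
    next
      case 2
      then show ?thesis by (simp add: delta_in_eq)
    next
      case 3
      then have i: "i \<in> nodes1 n" "i \<in> nodes n" using S by (auto simp: nodes1_def)
      have "b i \<le> (\<Sum>i\<in>nodes1 n. b i)"
        using i(1) fin b0 by (intro member_le_sum) auto
      then show ?thesis
        using 3 assms(2) by (simp add: B_bar_def sum_delta_in_singleton[OF x i(2)])
    qed
  qed
  have "\<exists>f. (\<forall>a\<in>arcs n. 0 \<le> f a \<and> f a \<le> x a) \<and> (\<forall>i\<in>nodes1 n. net_inflow (arcs n) f {i} = b i)"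
  proof (rule feasible_flow_exists[OF finite_arcs fin])
    show "\<forall>a\<in>arcs n. 0 \<le> x a"
      using x by (auto simp: P_AP_def PiE_iff)
  qed (use b0 cut in \<open>simp_all add: delta_in_eq\<close>)
  then obtain f where f: "\<And>a. a \<in> arcs n \<Longrightarrow> 0 \<le> f a \<and> f a \<le> x a"
    and flow: "\<And>i. i \<in> nodes1 n \<Longrightarrow> net_inflow (arcs n) f {i} = b i"
    by blast
  define g where "g = restrict f (arcs n)"
  have same: "net_inflow (arcs n) g {i} = net_inflow (arcs n) f {i}" for i
    unfolding net_inflow_def g_def by (intro sum.cong) auto
  have bal: "(\<Sum>a\<in>delta_out n {i}. g a) - (\<Sum>a\<in>delta_in n {i}. g a) = - b i"
    if "i \<in> nodes1 n" for i
    using flow[OF that] same[of i] net_inflow_arcs[of n g "{i}"] by linarith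
  have "(x, g) \<in> Q_SCF n b"
    unfolding Q_SCF_def using x f bal by (auto simp: g_def)
  then show "x \<in> P_SCF n b"
    unfolding P_SCF_def by blast
qed

end
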